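(* Let $n\ge 2$, let $M,N\in\mathbb{Z}^{n-1}$ and let $D=(D_1,\dots,D_{n-1})$ be a tuple of positive integers. For a tuple $T=(T_1,\dots,T_{n-1})$ write $\tilde T=(T_{n-1},T_{n-2},\dots,T_1)$. Then the long Weyl element Kloosterman sums satisfy $S_n(M,N;D)=S_n(\tilde M,\tilde N;\tilde D)$.
   Context: Definition of $S_n(M,N;D)$: $e(z)=e^{2\pi i z}$. $U$ is the group of upper triangular unipotent $n\times n$ matrices. For $N\in\mathbb{Z}^{n-1}$, $\psi_N$ is the character of $U(\mathbb{R})$, trivial on $U(\mathbb{Z})$, given by $\psi_N(u)=e(N_1u_{1,2}+N_2u_{2,3}+\cdots+N_{n-1}u_{n-1,n})$. For $M\in \mathbb{Z}^{n-1}$, $\tilde M=(M_{n-1},\dots,M_1)$. Let $w_0$ be the long Weyl element: the $n\times n$ matrix whose only nonzero entries are on the anti-diagonal, the entry at position $(n-k+1,k)$ being $(-1)^{k-1}$ ($1\le k\le n$). Let $c=\mathrm{Diag}(1/D_{n-1},\,D_{n-1}/D_{n-2},\dots,D_2/D_1,\,D_1)$, $C(c)=U(\mathbb{R})\,c\,w_0\,U(\mathbb{R})\cap SL(n,\mathbb{Z})$ and $X(c)=U(\mathbb{Z})\backslash C(c)/U(\mathbb{Z})$. Each $\gamma\in C(c)$ is uniquely $\gamma=b_1cw_0b_2$ with $b_1,b_2\in U(\mathbb{R})$; set $\mu(\gamma)=b_1\in U(\mathbb{Z})\backslash U(\mathbb{R})$ and $\mu'(\gamma)=b_2\in U(\mathbb{R})/U(\mathbb{Z})$.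 Then $$S_n(M,N;D)=\sum_{x\in X(c)}\psi_{\tilde M}(\mu(x))\,\psi_N(\mu'(x)).$$ *)

theory Defs
  imports Complex_Main "Jordan_Normal_Form.Determinant"
begin

text \<open>
  Matrices and vectors are those of \<open>Jordan_Normal_Form\<close>, whose indices start at 0:
  the entries \<open>u\<^sub>i\<^sub>,\<^sub>j\<close> and \<open>T\<^sub>i\<close> of the usual notation are \<open>u $$ (i - 1, j - 1)\<close>
  and \<open>T $ (i - 1)\<close>. Elements of \<open>SL(n, \<int>)\<close> and \<open>U(\<int>)\<close> are real matrices with integer entries.
\<close>

definition integral_mat :: "real mat \<Rightarrow> bool" where
  "integral_mat A \<longleftrightarrow> (\<forall>i<dim_row A. \<forall>j<dim_col A. A $$ (i, j) \<in> \<int>)"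

definition SL_Z :: "nat \<Rightarrow> real mat set" where
  "SL_Z n = {A \<in> carrier_mat n n. integral_mat A \<and> det A = 1}"

definition U_R :: "nat \<Rightarrow> real mat set" where
  "U_R n = {u \<in> carrier_mat n n. upper_triangular u \<and> (\<forall>i<n. u $$ (i, i) = 1)}"

definition U_Z :: "nat \<Rightarrow> real mat set" where
  "U_Z n = {u \<in> U_R n. integral_mat u}"

definition e_char :: "complex \<Rightarrow> complex" where
  "e_char z = exp (2 * of_real pi * \<i> * z)"

definition psi :: "int vec \<Rightarrow> real mat \<Rightarrow> complex" where
  "psi N u = e_char (\<Sum>i<dim_vec N. of_int (N $ i) * of_real (u $$ (i, Suc i)))"

definition tilde :: "'a vec \<Rightarrow> 'a vec" where
  "tilde T = vec (dim_vec T) (\<lambda>i. T $ (dim_vec T - 1 - i))"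

definition long_weyl :: "nat \<Rightarrow> real mat" where
  "long_weyl n = mat n n (\<lambda>(i, j). if i + j + 1 = n then (-1) ^ j else 0)"

text \<open>\<open>D\<^sub>1, \<dots>, D\<^sub>n\<^sub>-\<^sub>1\<close> with 1-based index, extended by \<open>D\<^sub>0 = D\<^sub>n = 1\<close>.\<close>

definition D_ext :: "nat \<Rightarrow> int vec \<Rightarrow> nat \<Rightarrow> real" where
  "D_ext n D k = (if k = 0 \<or> k = n then 1 else of_int (D $ (k - 1)))"

text \<open>
  \<open>Diag(1/D\<^sub>n\<^sub>-\<^sub>1, D\<^sub>n\<^sub>-\<^sub>1/D\<^sub>n\<^sub>-\<^sub>2, \<dots>, D\<^sub>2/D\<^sub>1, D\<^sub>1)\<close>: the \<open>k\<close>-th diagonal entry, counted from 1,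
  is \<open>D\<^sub>n\<^sub>-\<^sub>k\<^sub>+\<^sub>1/D\<^sub>n\<^sub>-\<^sub>k\<close>.
\<close>

definition c_mat :: "nat \<Rightarrow> int vec \<Rightarrow> real mat" where
  "c_mat n D = mat n n (\<lambda>(i, j). if i = j then D_ext n D (n - i) / D_ext n D (n - i - 1) else 0)"

definition C_set :: "nat \<Rightarrow> int vec \<Rightarrow> real mat set" where
  "C_set n D =
     {b1 * c_mat n D * long_weyl n * b2 | b1 b2. b1 \<in> U_R n \<and> b2 \<in> U_R n} \<inter> SL_Z n"

definition double_coset :: "nat \<Rightarrow> real mat \<Rightarrow> real mat set" where
  "double_coset n g = {u * g * v | u v. u \<in> U_Z n \<and> v \<in> U_Z n}"

definition X_set :: "nat \<Rightarrow> int vec \<Rightarrow> real mat set set" where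
  "X_set n D = double_coset n ` C_set n D"

text \<open>
  The factors of the unique decomposition \<open>g = b\<^sub>1 c w\<^sub>0 b\<^sub>2\<close>, as matrices rather than as classes
  modulo \<open>U(\<int>)\<close> on the left and on the right, respectively.
\<close>

definition mu :: "nat \<Rightarrow> int vec \<Rightarrow> real mat \<Rightarrow> real mat" where
  "mu n D g = (THE b1. b1 \<in> U_R n \<and>
     (\<exists>b2\<in>U_R n. g = b1 * c_mat n D * long_weyl n * b2))"

definition mu' :: "nat \<Rightarrow> int vec \<Rightarrow> real mat \<Rightarrow> real mat" where
  "mu' n D g = (THE b2. b2 \<in> U_R n \<and>
     (\<exists>b1\<in>U_R n. g = b1 * c_mat n D * long_weyl n * b2))"

text \<open>
  The summand is evaluated at an arbitrary representative of the double coset. Replacing \<open>g\<close> by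
  \<open>u * g * v\<close> with \<open>u\<close>, \<open>v\<close> in \<open>U(\<int>)\<close> replaces \<open>b\<^sub>1\<close>, \<open>b\<^sub>2\<close> by \<open>u * b\<^sub>1\<close>, \<open>b\<^sub>2 * v\<close>, and the
  characters are trivial on \<open>U(\<int>)\<close>, so the choice does not matter.
  The set of double cosets is finite, so the sum is a genuine one.
\<close>

definition kloosterman :: "nat \<Rightarrow> int vec \<Rightarrow> int vec \<Rightarrow> int vec \<Rightarrow> complex" where
  "kloosterman n M N D =
     (\<Sum>x\<in>X_set n D. let g = (SOME g. g \<in> x) in psi (tilde M) (mu n D g) * psi N (mu' n D g))"

end

theory Submission
  imports Defs
begin

text \<open>
  The contragredient map \<open>g \<mapsto> w\<^sub>0 (g\<^sup>-\<^sup>1)\<^sup>T w\<^sub>0\<^sup>-\<^sup>1\<close> is an involutive automorphism that preserves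
  \<open>SL(n, \<int>)\<close>, \<open>U(\<real>)\<close> and \<open>U(\<int>)\<close>. It fixes \<open>w\<^sub>0\<close> and maps the diagonal matrix \<open>c\<close> of \<open>D\<close> to that
  of the reversed tuple, hence it induces a bijection between the two sets of double cosets.
  On \<open>U(\<real>)\<close> it reverses the superdiagonal, because the sign of the inverse cancels
  against the alternating signs of \<open>w\<^sub>0\<close>; so it matches the characters of \<open>T\<close> and of the reversal of \<open>T\<close>,
  and the two sums agree term by term.
\<close>

section \<open>Square matrices\<close>

text \<open>Unlike \<open>mult_carrier_mat\<close>, this rule leaves the simplifier no dimension to guess.\<close>

lemma mult_carrier_square [simp]:
  "A \<in> carrier_mat n n \<Longrightarrow> B \<in> carrier_mat n n \<Longrightarrow> A * B \<in> carrier_mat n n"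
  by (rule mult_carrier_mat)

lemma mult_mat_entry:
  assumes "A \<in> carrier_mat n n" "B \<in> carrier_mat n n" "i < n" "j < n"
  shows "(A * B) $$ (i, j) = (\<Sum>k<n. A $$ (i, k) * B $$ (k, j))"
  using assms by (simp add: scalar_prod_def lessThan_atLeast0)

section \<open>Inverses by way of the adjugate\<close>

definition minv :: "'a::field mat \<Rightarrow> 'a mat" where
  "minv A = inverse (det A) \<cdot>\<^sub>m adj_mat A"

lemma minv:
  assumes "A \<in> carrier_mat n n" "det A \<noteq> 0"
  shows "minv A \<in> carrier_mat n n" "A * minv A = 1\<^sub>m n" "minv A * A = 1\<^sub>m n"
proof -
  note a = adj_mat[OF assms(1)]
  show "minv A \<in> carrier_mat n n" using a(1) by (simp add: minv_def)
  have "A * minv A = inverse (det A) \<cdot>\<^sub>m (A * adj_mat A)"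
    using mult_smult_distrib[OF assms(1) a(1)] by (simp add: minv_def)
  also have "\<dots> = 1\<^sub>m n" unfolding a(2) using assms(2) by (intro eq_matI) auto
  finally show *: "A * minv A = 1\<^sub>m n" .
  show "minv A * A = 1\<^sub>m n"
    using mat_mult_left_right_inverse[OF assms(1) _ *] a(1) by (simp add: minv_def)
qed

lemma det_minv:
  assumes "A \<in> carrier_mat n n" "det A \<noteq> 0"
  shows "det (minv A) = inverse (det A)"
proof -
  have "det A * det (minv A) = 1"
    using det_mult[OF assms(1) minv(1)[OF assms]] minv(2)[OF assms] by simp
  then show ?thesis using assms(2) by (simp add: field_simps)
qed

text \<open>Multiplicativity of the determinant turns a right inverse into
  \<open>det A \<noteq> 0\<close>, so inverses of explicit matrices can be recognised by a single
  product.\<close>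

lemma minv_unique:
  assumes A: "A \<in> carrier_mat n n" and B: "B \<in> carrier_mat n n"
    and AB: "A * B = 1\<^sub>m n"
  shows "minv A = B"
proof -
  have d: "det A \<noteq> 0" using det_mult[OF A B] AB by auto
  note m = minv[OF A d]
  have "minv A = minv A * (A * B)" using AB m by simp
  also have "\<dots> = (minv A * A) * B" using m(1) A B by (simp add: assoc_mult_mat[of _ n n _ n _ n])
  also have "\<dots> = B" using m(3) B by simp
  finally show ?thesis .
qed

lemma minv_mult:
  assumes A: "A \<in> carrier_mat n n" "det A \<noteq> 0" and B: "B \<in> carrier_mat n n" "det B \<noteq> 0"
  shows "minv (A * B) = minv B * minv A"
proof (rule minv_unique)
  note a = minv[OF A] and b = minv[OF B]
  have "A * B * (minv B * minv A) = A * ((B * minv B) * minv A)"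
    using a(1) b(1) A(1) B(1) by (simp add: assoc_mult_mat[of _ n n _ n _ n])
  also have "\<dots> = 1\<^sub>m n" using a b by simp
  finally show "A * B * (minv B * minv A) = 1\<^sub>m n" .
qed (use A(1) B(1) minv(1)[OF A] minv(1)[OF B] in auto)

lemma det_Ints:
  assumes "A \<in> carrier_mat n n" "integral_mat A"
  shows "det A \<in> \<int>"
  unfolding det_def'[OF assms(1)]
proof (intro Ints_sum Ints_mult Ints_prod)
  fix p i assume "p \<in> {p. p permutes {0..<n}}" "i \<in> {0..<n}"
  then have "p i < n" "i < n" using permutes_in_image[of p "{0..<n}" i] by auto
  then show "A $$ (i, p i) \<in> \<int>" using assms by (auto simp: integral_mat_def)
qed (simp add: sign_def)

text \<open>For determinant 1 the inverse is the adjugate itself, and its entries are signed minors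
  of an integral matrix.\<close>

lemma integral_mat_minv:
  assumes A: "A \<in> carrier_mat n n" "det A = 1" "integral_mat A"
  shows "integral_mat (minv A)"
proof -
  have "cofactor A j i \<in> \<int>" if "i < n" "j < n" for i j
    unfolding cofactor_def
  proof (intro Ints_mult det_Ints)
    show "mat_delete A j i \<in> carrier_mat (n - 1) (n - 1)" by (rule mat_delete_carrier[OF A(1)])
    show "integral_mat (mat_delete A j i)"
      using A(1,3) by (auto simp: integral_mat_def mat_delete_def)
  qed simp
  then show ?thesis using A(1,2) by (auto simp: integral_mat_def minv_def adj_mat_def)
qed

section \<open>Unipotent matrices\<close>

lemma U_R_D:
  assumes "u \<in> U_R n"
  shows "u \<in> carrier_mat n n" "det u = 1"
    and "\<And>i j. j < i \<Longrightarrow> i < n \<Longrightarrow> u $$ (i, j) = 0" "\<And>i. i < n \<Longrightarrow> u $$ (i, i) = 1"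
proof -
  show c: "u \<in> carrier_mat n n"
    and z: "\<And>i j. j < i \<Longrightarrow> i < n \<Longrightarrow> u $$ (i, j) = 0"
    and o: "\<And>i. i < n \<Longrightarrow> u $$ (i, i) = 1"
    using assms by (auto simp: U_R_def upper_triangular_def)
  have "det u = (\<Prod>i=0..<n. u $$ (i, i))"
    using assms det_upper_triangular[of u n] c by (auto simp: U_R_def prod_list_diag_prod)
  then show "det u = 1" using o by simp
qed

lemma U_R_I:
  assumes "u \<in> carrier_mat n n" "\<And>i j. j < i \<Longrightarrow> i < n \<Longrightarrow> u $$ (i, j) = 0"
    "\<And>i. i < n \<Longrightarrow> u $$ (i, i) = 1"
  shows "u \<in> U_R n"
  using assms by (auto simp: U_R_def upper_triangular_def)

lemma sum_two:
  fixes f :: "nat \<Rightarrow> 'a::comm_monoid_add"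
  assumes "Suc i < n" "\<And>k. k < n \<Longrightarrow> k \<noteq> i \<Longrightarrow> k \<noteq> Suc i \<Longrightarrow> f k = 0"
  shows "(\<Sum>k<n. f k) = f i + f (Suc i)"
proof -
  have "(\<Sum>k<n. f k) = (\<Sum>k\<in>{i, Suc i}. f k)"
    using assms by (intro sum.mono_neutral_right) auto
  then show ?thesis by simp
qed

text \<open>At position \<open>(i, Suc i)\<close> only the summands \<open>k = i\<close> and
  \<open>k = Suc i\<close> survive, each with one diagonal factor 1. This additivity is what makes
  \<open>psi\<close> a character.\<close>

lemma U_R_mult:
  assumes u: "u \<in> U_R n" and v: "v \<in> U_R n"
  shows "u * v \<in> U_R n"
    and "Suc i < n \<Longrightarrow> (u * v) $$ (i, Suc i) = u $$ (i, Suc i) + v $$ (i, Suc i)"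
proof -
  note U = U_R_D[OF u] and V = U_R_D[OF v]
  have e: "(u * v) $$ (i, j) = (\<Sum>k<n. u $$ (i, k) * v $$ (k, j))" if "i < n" "j < n" for i j
    using mult_mat_entry[OF U(1) V(1) that] .
  show "u * v \<in> U_R n"
  proof (rule U_R_I)
    show "u * v \<in> carrier_mat n n" using U(1) V(1) by simp
    show "(u * v) $$ (i, j) = 0" if "j < i" "i < n" for i j
    proof -
      \<comment> \<open>If \<open>k < i\<close> the first factor lies below the diagonal; otherwise
        \<open>j < i \<le> k\<close> and the second one does.\<close>
      have "u $$ (i, k) * v $$ (k, j) = 0" if "k < n" for k
        using U(3)[of k i] V(3)[of j k] \<open>j < i\<close> \<open>i < n\<close> that by (cases "k < i") auto
      then show ?thesis using e[of i j] that by (auto intro!: sum.neutral)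
    qed
    show "(u * v) $$ (i, i) = 1" if "i < n" for i
    proof -
      have "u $$ (i, k) * v $$ (k, i) = (if k = i then 1 else 0)" if "k < n" for k
        using U(3)[of k i] V(3)[of i k] U(4)[of i] V(4)[of i] \<open>i < n\<close> that
        by (cases k i rule: linorder_cases) auto
      then show ?thesis using e[of i i] that by simp
    qed
  qed
  show "(u * v) $$ (i, Suc i) = u $$ (i, Suc i) + v $$ (i, Suc i)" if i: "Suc i < n"
  proof -
    have "u $$ (i, k) * v $$ (k, Suc i) = 0" if "k < n" "k \<noteq> i" "k \<noteq> Suc i" for k
      using U(3)[of k i] V(3)[of "Suc i" k] i that by (cases "k < i") auto
    then show ?thesis
      using e[of i "Suc i"] sum_two[OF i, of "\<lambda>k. u $$ (i, k) * v $$ (k, Suc i)"] U(4) V(4) i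
      by simp
  qed
qed

lemma one_U_Z: "1\<^sub>m n \<in> U_Z n"
  by (auto simp: U_Z_def integral_mat_def intro!: U_R_I)

lemma U_Z_U_R: "u \<in> U_Z n \<Longrightarrow> u \<in> U_R n"
  by (simp add: U_Z_def)

text \<open>Back substitution in \<open>u * minv u = 1\<close>.\<close>

lemma U_R_minv:
  assumes u: "u \<in> U_R n"
  shows "minv u \<in> U_R n"
proof -
  note U = U_R_D[OF u]
  have "det u \<noteq> 0" using U(2) by simp
  note m = minv[OF U(1) this]
  have e: "(\<Sum>k<n. u $$ (i, k) * minv u $$ (k, j)) = (if i = j then 1 else 0)"
    if "i < n" "j < n" for i j
    using mult_mat_entry[OF U(1) m(1) that] m(2) that by simp
  \<comment> \<open>Once column \<open>j\<close> of the inverse vanishes below row \<open>i\<close>,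
    only the diagonal term of row \<open>i\<close> of \<open>u\<close> contributes.\<close>
  have split: "(\<Sum>k<n. u $$ (i, k) * minv u $$ (k, j)) = minv u $$ (i, j)"
    if "i < n" "\<And>k. i < k \<Longrightarrow> k < n \<Longrightarrow> minv u $$ (k, j) = 0" for i j
  proof -
    have "u $$ (i, k) * minv u $$ (k, j) = (if k = i then minv u $$ (i, j) else 0)"
      if "k < n" for k
      using U(3)[of k i] U(4)[of i] \<open>i < n\<close> that \<open>\<And>k. i < k \<Longrightarrow> k < n \<Longrightarrow> minv u $$ (k, j) = 0\<close>[of k]
      by (cases k i rule: linorder_cases) auto
    then show ?thesis using \<open>i < n\<close> by simp
  qed
  have z: "minv u $$ (i, j) = 0" if "j < i" "i < n" for i j
    using that
  \<comment> \<open>Induction on \<open>n - i\<close> runs from the bottom row upwards.\<close>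
  proof (induction "n - i" arbitrary: i rule: less_induct)
    case less
    have "minv u $$ (k, j) = 0" if "i < k" "k < n" for k
      using less.hyps[of k] less.prems that by auto
    then show ?case using split[of i j] e[of i j] less.prems by simp
  qed
  show ?thesis
  proof (rule U_R_I)
    show "minv u $$ (i, i) = 1" if "i < n" for i
      using split[of i i] e[of i i] z that by simp
  qed (use m(1) z in auto)
qed

text \<open>Superdiagonals add under multiplication, and that of the identity is zero.\<close>

lemma U_R_minv_superdiag:
  assumes u: "u \<in> U_R n" and i: "Suc i < n"
  shows "minv u $$ (i, Suc i) = - u $$ (i, Suc i)"
  using U_R_mult(2)[OF u U_R_minv[OF u] i] minv(2)[OF U_R_D(1)[OF u]] U_R_D(2)[OF u] i by simp

lemma U_Z_minv: "u \<in> U_Z n \<Longrightarrow> minv u \<in> U_Z n"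
  using integral_mat_minv[of u n] by (auto simp: U_Z_def U_R_minv U_R_D)

section \<open>The contragredient automorphism\<close>

lemma long_weyl_carrier [simp]:
  "long_weyl n \<in> carrier_mat n n" "dim_row (long_weyl n) = n" "dim_col (long_weyl n) = n"
  by (simp_all add: long_weyl_def)

lemma long_weyl_entry:
  "i < n \<Longrightarrow> j < n \<Longrightarrow> long_weyl n $$ (i, j) = (if j = n - 1 - i then (-1) ^ j else 0)"
  by (auto simp: long_weyl_def)

lemma long_weyl_mult_entry:
  assumes "A \<in> carrier_mat n n" "i < n" "j < n"
  shows "(long_weyl n * A) $$ (i, j) = (-1) ^ (n - 1 - i) * A $$ (n - 1 - i, j)"
proof -
  have "(long_weyl n * A) $$ (i, j) = (\<Sum>k<n. long_weyl n $$ (i, k) * A $$ (k, j))"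
    using mult_mat_entry[OF _ assms] by simp
  also have "\<dots> = (\<Sum>k<n. if k = n - 1 - i then (-1) ^ k * A $$ (k, j) else 0)"
    using assms by (intro sum.cong) (auto simp: long_weyl_entry)
  finally show ?thesis using assms by simp
qed

section \<open>Signed reflection in the antidiagonal\<close>

definition flip :: "nat \<Rightarrow> real mat \<Rightarrow> real mat" where
  "flip n A = long_weyl n * transpose_mat A * transpose_mat (long_weyl n)"

lemma flip_carrier [simp]: "A \<in> carrier_mat n n \<Longrightarrow> flip n A \<in> carrier_mat n n"
  by (simp add: flip_def)

text \<open>Transposing and then reversing rows and columns reflects in the antidiagonal. The two
  signs contributed by \<open>long_weyl\<close> combine to the parity of \<open>i + j\<close>,
  whatever \<open>n\<close> is.\<close>

lemma flip_entry:
  assumes A: "A \<in> carrier_mat n n" and ij: "i < n" "j < n"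
  shows "flip n A $$ (i, j) = (-1) ^ (i + j) * A $$ (n - 1 - j, n - 1 - i)"
proof -
  let ?W = "long_weyl n"
  have T: "transpose_mat A \<in> carrier_mat n n" using A by simp
  have "flip n A $$ (i, j) = (\<Sum>k<n. (?W * transpose_mat A) $$ (i, k) * transpose_mat ?W $$ (k, j))"
    unfolding flip_def using A ij by (intro mult_mat_entry) auto
  also have "\<dots> = (\<Sum>k<n. if k = n - 1 - j
      then ((-1) ^ (n - 1 - i) * (-1) ^ (n - 1 - j)) * A $$ (k, n - 1 - i) else 0)"
    using A ij long_weyl_mult_entry[OF T]
    by (intro sum.cong) (auto simp: long_weyl_entry simp del: index_mult_mat(1))
  also have "\<dots> = ((-1) ^ (n - 1 - i) * (-1) ^ (n - 1 - j)) * A $$ (n - 1 - j, n - 1 - i)"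
    using ij by simp
  also have "(-1) ^ (n - 1 - i) * (-1) ^ (n - 1 - j) = ((-1) ^ (i + j) :: real)"
  proof -
    \<comment> \<open>Both exponents together with \<open>i + j\<close> add up to an even number, so
      the parities agree.\<close>
    have "(n - 1 - i) + (n - 1 - j) + (i + j) = 2 * (n - 1)" using ij by linarith
    then have "even ((n - 1 - i) + (n - 1 - j) + (i + j))" by simp
    then have "(-1) ^ ((n - 1 - i) + (n - 1 - j)) = ((-1) ^ (i + j) :: real)"
      by (simp add: minus_one_power_iff)
    then show ?thesis by (simp add: power_add)
  qed
  finally show ?thesis .
qed

lemma long_weyl_orthogonal:
  "long_weyl n * transpose_mat (long_weyl n) = 1\<^sub>m n"
  "transpose_mat (long_weyl n) * long_weyl n = 1\<^sub>m n"
proof -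
  show *: "long_weyl n * transpose_mat (long_weyl n) = 1\<^sub>m n"
  proof (rule eq_matI)
    fix i j assume "i < dim_row (1\<^sub>m n)" "j < dim_col (1\<^sub>m n)"
    then have ij: "i < n" "j < n" by auto
    then show "(long_weyl n * transpose_mat (long_weyl n)) $$ (i, j) = 1\<^sub>m n $$ (i, j)"
      using long_weyl_mult_entry[of "transpose_mat (long_weyl n)" n i j]
      by (auto simp: long_weyl_entry simp del: index_mult_mat(1) simp flip: power_mult_distrib)
  qed auto
  show "transpose_mat (long_weyl n) * long_weyl n = 1\<^sub>m n"
    by (rule mat_mult_left_right_inverse[OF _ _ *]) auto
qed

lemma det_long_weyl_sq: "det (long_weyl n) * det (long_weyl n) = 1"
  using det_mult[of "long_weyl n" n "transpose_mat (long_weyl n)"]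
  by (simp add: long_weyl_orthogonal det_transpose[of _ n])

lemma det_long_weyl_nonzero: "det (long_weyl n) \<noteq> 0"
  using det_long_weyl_sq[of n] by auto

lemma det_flip:
  assumes "A \<in> carrier_mat n n"
  shows "det (flip n A) = det A"
proof -
  have "det (flip n A) = det A * (det (long_weyl n) * det (long_weyl n))"
    using assms by (simp add: flip_def det_mult[of _ n] det_transpose[of _ n])
  then show ?thesis by (simp add: det_long_weyl_sq)
qed

text \<open>Transposition reverses the product, and orthogonality of \<open>long_weyl\<close>
  cancels the two inner factors.\<close>

lemma flip_mult:
  assumes A: "A \<in> carrier_mat n n" and B: "B \<in> carrier_mat n n"
  shows "flip n (A * B) = flip n B * flip n A"
proof -
  let ?W = "long_weyl n" and ?V = "transpose_mat (long_weyl n)"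
  let ?A = "transpose_mat A" and ?B = "transpose_mat B"
  have c: "?A \<in> carrier_mat n n" "?B \<in> carrier_mat n n" "?V \<in> carrier_mat n n" using A B by auto
  have "flip n B * flip n A = ?W * (?B * ((?V * ?W) * (?A * ?V)))"
    using c by (simp add: flip_def assoc_mult_mat[of _ n n _ n _ n])
  also have "\<dots> = ?W * (?B * ?A) * ?V"
    using c by (simp add: long_weyl_orthogonal assoc_mult_mat[of _ n n _ n _ n])
  finally show ?thesis using transpose_mult[OF A B] by (simp add: flip_def)
qed

lemma flip_flip:
  assumes A: "A \<in> carrier_mat n n"
  shows "flip n (flip n A) = A"
proof (rule eq_matI)
  fix i j assume "i < dim_row A" "j < dim_col A"
  then have ij: "i < n" "j < n" using A by auto
  have "(i + j) + ((n - 1 - j) + (n - 1 - i)) = 2 * (n - 1)" using ij by linarith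
  then have "(-1::real) ^ ((i + j) + ((n - 1 - j) + (n - 1 - i))) = 1" by simp
  then have "(-1::real) ^ (i + j) * (-1) ^ ((n - 1 - j) + (n - 1 - i)) = 1"
    by (simp only: power_add)
  then show "flip n (flip n A) $$ (i, j) = A $$ (i, j)"
    using A ij by (simp add: flip_entry)
qed (use A in \<open>auto simp: flip_def\<close>)

lemma flip_one: "flip n (1\<^sub>m n) = 1\<^sub>m n"
  by (simp add: flip_def long_weyl_orthogonal)

lemma integral_flip:
  assumes "A \<in> carrier_mat n n" "integral_mat A"
  shows "integral_mat (flip n A)"
proof -
  have "dim_row (flip n A) = n" "dim_col (flip n A) = n" by (auto simp: flip_def)
  with assms show ?thesis
    by (auto simp: integral_mat_def flip_entry intro!: Ints_mult Ints_power)
qed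

text \<open>Reflection in the antidiagonal maps the lower triangle to itself, and the sign on the
  diagonal is \<open>(-1) ^ (i + i) = 1\<close>.\<close>

lemma U_R_flip:
  assumes "u \<in> U_R n"
  shows "flip n u \<in> U_R n"
proof (rule U_R_I)
  note U = U_R_D[OF assms]
  show "flip n u \<in> carrier_mat n n" using U(1) by simp
  show "flip n u $$ (i, j) = 0" if "j < i" "i < n" for i j
    using that U(3)[of "n - 1 - i" "n - 1 - j"] by (simp add: flip_entry[OF U(1)])
  show "flip n u $$ (i, i) = 1" if "i < n" for i
    using that U(4)[of "n - 1 - i"] by (simp add: flip_entry[OF U(1)])
qed

text \<open>A map that reverses products and fixes the identity commutes with inversion.\<close>

lemma flip_minv:
  assumes A: "A \<in> carrier_mat n n" "det A \<noteq> 0"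
  shows "minv (flip n A) = flip n (minv A)"
proof (rule minv_unique)
  show "flip n A * flip n (minv A) = 1\<^sub>m n"
    using flip_mult[OF minv(1)[OF A] A(1)] minv(3)[OF A] by (simp add: flip_one)
qed (use A(1) minv(1)[OF A] in auto)

section \<open>Inversion combined with the reflection\<close>

definition contra :: "nat \<Rightarrow> real mat \<Rightarrow> real mat" where
  "contra n A = flip n (minv A)"

lemma contra:
  assumes A: "A \<in> carrier_mat n n" "det A \<noteq> 0"
  shows "contra n A \<in> carrier_mat n n" "det (contra n A) = inverse (det A)"
    "contra n (contra n A) = A"
proof -
  note m = minv[OF A]
  show "contra n A \<in> carrier_mat n n" using m by (simp add: contra_def)
  show "det (contra n A) = inverse (det A)"
    using m det_minv[OF A] by (simp add: contra_def det_flip)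
  have "minv (minv A) = A" by (rule minv_unique[OF m(1) A(1) m(3)])
  then show "contra n (contra n A) = A"
    using flip_minv[OF m(1)] A det_minv[OF A] by (simp add: contra_def flip_flip)
qed

text \<open>\<open>minv\<close> and \<open>flip\<close> each reverse products, so their composite
  preserves the order.\<close>

lemma contra_mult:
  assumes "A \<in> carrier_mat n n" "det A \<noteq> 0" "B \<in> carrier_mat n n" "det B \<noteq> 0"
  shows "contra n (A * B) = contra n A * contra n B"
  using minv_mult[OF assms] flip_mult[OF minv(1)[OF assms(3,4)] minv(1)[OF assms(1,2)]]
  by (simp add: contra_def)

lemma contra_U_R: "u \<in> U_R n \<Longrightarrow> contra n u \<in> U_R n"
  by (simp add: contra_def U_R_minv U_R_flip)

lemma contra_U_Z: "u \<in> U_Z n \<Longrightarrow> contra n u \<in> U_Z n"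
  using U_Z_minv[of u n] integral_flip[of "minv u" n]
  by (auto simp: contra_def U_Z_def U_R_flip U_R_D)

lemma contra_SL_Z:
  assumes "g \<in> SL_Z n"
  shows "contra n g \<in> SL_Z n"
proof -
  have g: "g \<in> carrier_mat n n" "integral_mat g" "det g = 1" using assms by (auto simp: SL_Z_def)
  then show ?thesis
    using contra[of g n] integral_flip[OF minv(1)[of g n] integral_mat_minv[of g n]]
    by (auto simp: SL_Z_def contra_def)
qed

text \<open>By orthogonality the inverse is the transpose; transposing back leaves
  \<open>long_weyl\<close> conjugated by itself.\<close>

lemma contra_long_weyl: "contra n (long_weyl n) = long_weyl n"
proof -
  have "minv (long_weyl n) = transpose_mat (long_weyl n)"
    by (rule minv_unique[of _ n]) (auto simp: long_weyl_orthogonal)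
  then show ?thesis
    by (simp add: contra_def flip_def long_weyl_orthogonal assoc_mult_mat[of _ n n _ n _ n])
qed

text \<open>The exponent \<open>i + Suc i\<close> is odd, so \<open>flip\<close> contributes a minus
  sign that cancels the one from inversion. Counted from 0, superdiagonal entry \<open>i\<close>
  comes from entry \<open>n - 2 - i\<close>.\<close>

lemma contra_superdiag:
  assumes u: "u \<in> U_R n" and i: "Suc i < n"
  shows "contra n u $$ (i, Suc i) = u $$ (n - 2 - i, n - 1 - i)"
proof -
  have "contra n u $$ (i, Suc i) = - minv u $$ (n - 2 - i, n - 1 - i)"
    using flip_entry[OF U_R_D(1)[OF U_R_minv[OF u]], of i "Suc i"] i
    by (simp add: contra_def minus_one_power_iff diff_diff_eq)
  moreover have "Suc (n - 2 - i) = n - 1 - i" using i by simp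
  ultimately show ?thesis using U_R_minv_superdiag[OF u, of "n - 2 - i"] i by simp
qed

section \<open>Characters\<close>

lemma tilde_carrier [simp]: "T \<in> carrier_vec m \<Longrightarrow> tilde T \<in> carrier_vec m"
  by (auto simp: tilde_def)

lemma tilde_index: "T \<in> carrier_vec m \<Longrightarrow> i < m \<Longrightarrow> tilde T $ i = T $ (m - 1 - i)"
  by (auto simp: tilde_def)

lemma tilde_tilde: "tilde (tilde T) = T"
  by (auto simp: tilde_def)

lemma psi_mult:
  assumes "N \<in> carrier_vec (n - 1)" "u \<in> U_R n" "v \<in> U_R n"
  shows "psi N (u * v) = psi N u * psi N v"
proof -
  have "(\<Sum>i<dim_vec N. of_int (N $ i) * complex_of_real ((u * v) $$ (i, Suc i))) =
      (\<Sum>i<dim_vec N. of_int (N $ i) * complex_of_real (u $$ (i, Suc i))) +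
      (\<Sum>i<dim_vec N. of_int (N $ i) * complex_of_real (v $$ (i, Suc i)))"
    unfolding sum.distrib[symmetric] using assms
    by (intro sum.cong) (auto simp: U_R_mult(2) algebra_simps simp del: index_mult_mat(1))
  then show ?thesis by (simp add: psi_def e_char_def ring_distribs exp_add)
qed

text \<open>The argument of \<open>e_char\<close> is an integer here, and the exponential has period
  \<open>2 * pi * \<i>\<close>.\<close>

lemma psi_U_Z:
  assumes "N \<in> carrier_vec (n - 1)" "u \<in> U_Z n"
  shows "psi N u = 1"
proof -
  have u: "u \<in> carrier_mat n n" "integral_mat u"
    using assms(2) by (auto simp: U_Z_def U_R_D)
  have "(\<Sum>i<dim_vec N. of_int (N $ i) * complex_of_real (u $$ (i, Suc i))) \<in> \<int>"
  proof (intro Ints_sum Ints_mult)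
    fix i assume "i \<in> {..<dim_vec N}"
    then have "u $$ (i, Suc i) \<in> \<int>" using u assms(1) by (auto simp: integral_mat_def)
    then show "complex_of_real (u $$ (i, Suc i)) \<in> \<int>" by (auto elim!: Ints_cases)
  qed auto
  then obtain k :: int where
    "(\<Sum>i<dim_vec N. of_int (N $ i) * complex_of_real (u $$ (i, Suc i))) = of_int k"
    by (auto elim!: Ints_cases)
  then show ?thesis
    using cis_multiple_2pi[of "of_int k"]
    by (simp add: psi_def e_char_def cis_conv_exp mult_ac)
qed

text \<open>Both the coefficients and the superdiagonal are reversed, so the sum is only read
  backwards.\<close>

lemma psi_contra:
  assumes N: "N \<in> carrier_vec (n - 1)" and u: "u \<in> U_R n"
  shows "psi (tilde N) (contra n u) = psi N u"
proof -
  let ?f = "\<lambda>i. of_int (N $ i) * complex_of_real (u $$ (i, Suc i))"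
  have "(\<Sum>i<n - 1. of_int (tilde N $ i) * complex_of_real (contra n u $$ (i, Suc i))) =
      (\<Sum>i<n - 1. ?f (n - 1 - Suc i))"
  proof (intro sum.cong refl)
    fix i assume "i \<in> {..<n - 1}"
    then have i: "i < n - 1" by simp
    then have "Suc (n - Suc (Suc i)) = n - Suc i" by simp
    then show "of_int (tilde N $ i) * complex_of_real (contra n u $$ (i, Suc i)) =
        ?f (n - 1 - Suc i)"
      using i by (simp add: tilde_index[OF N] contra_superdiag[OF u])
  qed
  also have "\<dots> = (\<Sum>i<n - 1. ?f i)" by (rule sum.nat_diff_reindex)
  finally show ?thesis using carrier_vecD[OF N] carrier_vecD[OF tilde_carrier[OF N]] by (simp add: psi_def)
qed

section \<open>The big Bruhat cell\<close>

definition pos_vec :: "nat \<Rightarrow> int vec \<Rightarrow> bool" where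
  "pos_vec n D \<longleftrightarrow> n \<ge> 2 \<and> D \<in> carrier_vec (n - 1) \<and> (\<forall>i<n - 1. D $ i > 0)"

lemma pos_vec_tilde: "pos_vec n D \<Longrightarrow> pos_vec n (tilde D)"
  by (auto simp: pos_vec_def tilde_index)

lemma D_ext_pos: "pos_vec n D \<Longrightarrow> k \<le> n \<Longrightarrow> D_ext n D k > 0"
  by (auto simp: pos_vec_def D_ext_def)

text \<open>The conventions at \<open>0\<close> and \<open>n\<close> are exchanged by
  \<open>k \<mapsto> n - k\<close>, so the symmetry includes the end points.\<close>

lemma D_ext_tilde: "pos_vec n D \<Longrightarrow> k \<le> n \<Longrightarrow> D_ext n (tilde D) k = D_ext n D (n - k)"
  by (auto simp: pos_vec_def D_ext_def tilde_index)

lemma c_mat_carrier [simp]: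
  "c_mat n D \<in> carrier_mat n n" "dim_row (c_mat n D) = n" "dim_col (c_mat n D) = n"
  by (simp_all add: c_mat_def)

lemma c_mat_entry:
  "i < n \<Longrightarrow> j < n \<Longrightarrow> c_mat n D $$ (i, j) =
    (if i = j then D_ext n D (n - i) / D_ext n D (n - i - 1) else 0)"
  by (simp add: c_mat_def)

lemma c_mat_mult_entry:
  assumes "A \<in> carrier_mat n n" "i < n" "j < n"
  shows "(c_mat n D * A) $$ (i, j) = c_mat n D $$ (i, i) * A $$ (i, j)"
proof -
  have "(c_mat n D * A) $$ (i, j) = (\<Sum>k<n. c_mat n D $$ (i, k) * A $$ (k, j))"
    using mult_mat_entry[OF _ assms] by simp
  also have "\<dots> = (\<Sum>k<n. if k = i then c_mat n D $$ (i, i) * A $$ (i, j) else 0)"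
    using assms by (intro sum.cong) (auto simp: c_mat_entry)
  finally show ?thesis using assms by simp
qed

text \<open>Entry \<open>i\<close> of the reflected \<open>c_mat n (tilde D)\<close> is
  \<open>D_ext n D (n - i - 1) / D_ext n D (n - i)\<close>, the reciprocal of entry \<open>i\<close>
  of \<open>c_mat n D\<close>. The reflection is thus the inverse, and reflecting once more gives
  the claim.\<close>

lemma contra_c_mat:
  assumes D: "pos_vec n D"
  shows "contra n (c_mat n D) = c_mat n (tilde D)" "det (c_mat n D) \<noteq> 0"
proof -
  have eq: "c_mat n D * flip n (c_mat n (tilde D)) = 1\<^sub>m n"
  proof (rule eq_matI)
    fix i j assume "i < dim_row (1\<^sub>m n)" "j < dim_col (1\<^sub>m n)"
    then have ij: "i < n" "j < n" by auto
    let ?F = "flip n (c_mat n (tilde D))"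
    have F: "?F $$ (i, j) = (-1) ^ (i + j) * c_mat n (tilde D) $$ (n - 1 - j, n - 1 - i)"
      using flip_entry[OF c_mat_carrier(1) ij] .
    have m: "(c_mat n D * ?F) $$ (i, j) = c_mat n D $$ (i, i) * ?F $$ (i, j)"
      using c_mat_mult_entry[OF _ ij] by simp
    show "(c_mat n D * ?F) $$ (i, j) = 1\<^sub>m n $$ (i, j)"
    proof (cases "i = j")
      case True
      have "n - (n - 1 - i) = Suc i" "n - (n - 1 - i) - 1 = i" using ij by linarith+
      then have "c_mat n (tilde D) $$ (n - 1 - i, n - 1 - i)
          = D_ext n D (n - Suc i) / D_ext n D (n - i)"
        using ij D_ext_tilde[OF D, of "Suc i"] D_ext_tilde[OF D, of i] by (simp add: c_mat_entry)
      moreover have "D_ext n D (n - i) > 0" "D_ext n D (n - Suc i) > 0"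
        using D_ext_pos[OF D] by auto
      ultimately show ?thesis unfolding m F using True ij by (simp add: c_mat_entry)
    next
      case False
      then have "n - 1 - j \<noteq> n - 1 - i" using ij by linarith
      then show ?thesis unfolding m F using False ij by (simp add: c_mat_entry)
    qed
  qed (auto simp: flip_def)
  show "det (c_mat n D) \<noteq> 0"
    using det_mult[of "c_mat n D" n "flip n (c_mat n (tilde D))"] eq by auto
  show "contra n (c_mat n D) = c_mat n (tilde D)"
    unfolding contra_def minv_unique[OF _ _ eq, simplified] by (simp add: flip_flip)
qed

text \<open>Treats the two middle factors as one monomial matrix supported on the
  antidiagonal.\<close>

lemma cell_middle:
  assumes D: "pos_vec n D"
  defines "K \<equiv> c_mat n D * long_weyl n"
  shows "K \<in> carrier_mat n n" "det K \<noteq> 0" "contra n K = c_mat n (tilde D) * long_weyl n"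
    "\<And>i j. i < n \<Longrightarrow> j < n \<Longrightarrow> K $$ (i, j) \<noteq> 0 \<longleftrightarrow> j = n - 1 - i"
proof -
  show K: "K \<in> carrier_mat n n" by (simp add: K_def)
  show "det K \<noteq> 0" using contra_c_mat(2)[OF D] det_long_weyl_nonzero
    by (simp add: K_def det_mult[of _ n])
  show "contra n K = c_mat n (tilde D) * long_weyl n"
    unfolding K_def
    using contra_mult[of "c_mat n D" n "long_weyl n"] contra_c_mat[OF D] det_long_weyl_nonzero
    by (simp add: contra_long_weyl)
  show "K $$ (i, j) \<noteq> 0 \<longleftrightarrow> j = n - 1 - i" if "i < n" "j < n" for i j
    using that c_mat_mult_entry[of "long_weyl n" n i j D]
      D_ext_pos[OF D, of "n - i"] D_ext_pos[OF D, of "n - i - 1"]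
    by (auto simp: K_def long_weyl_entry c_mat_entry simp del: index_mult_mat(1))
qed

text \<open>\<open>c w\<^sub>0\<close> conjugates lower triangular matrices to upper triangular ones, so an intertwining
  pair of unipotent matrices is trivial.\<close>

lemma cell_intertwine:
  assumes D: "pos_vec n D" and a: "a \<in> U_R n" and d: "d \<in> U_R n"
    and eq: "a * (c_mat n D * long_weyl n) = (c_mat n D * long_weyl n) * d"
  shows "a = 1\<^sub>m n" "d = 1\<^sub>m n"
proof -
  define K where "K = c_mat n D * long_weyl n"
  note K = cell_middle[OF D, folded K_def]
  note A = U_R_D[OF a] and E = U_R_D[OF d]
  \<comment> \<open>Compare both sides at \<open>(i, n - 1 - l)\<close>. On the left the column of
    \<open>K\<close> isolates \<open>a $$ (i, l)\<close>; on the right the row of \<open>K\<close>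
    selects the entry of \<open>d\<close> at \<open>(n - 1 - i, n - 1 - l)\<close>, which lies below
    the diagonal.\<close>
  have "a $$ (i, l) = 0" if il: "i < l" "l < n" for i l
  proof -
    have "(a * K) $$ (i, n - 1 - l) = (\<Sum>k<n. a $$ (i, k) * K $$ (k, n - 1 - l))"
      using il by (intro mult_mat_entry[OF A(1) K(1)]) auto
    also have "\<dots> = (\<Sum>k<n. if k = l then a $$ (i, l) * K $$ (l, n - 1 - l) else 0)"
    proof (intro sum.cong refl)
      fix k assume "k \<in> {..<n}"
      then show "a $$ (i, k) * K $$ (k, n - 1 - l) =
          (if k = l then a $$ (i, l) * K $$ (l, n - 1 - l) else 0)"
        using K(4)[of k "n - 1 - l"] il by (cases "k = l") auto
    qed
    also have "\<dots> = a $$ (i, l) * K $$ (l, n - 1 - l)" using il by simp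
    finally have 1: "(a * K) $$ (i, n - 1 - l) = a $$ (i, l) * K $$ (l, n - 1 - l)" .
    have "(K * d) $$ (i, n - 1 - l) = (\<Sum>k<n. K $$ (i, k) * d $$ (k, n - 1 - l))"
      using il by (intro mult_mat_entry[OF K(1) E(1)]) auto
    also have "\<dots> = 0"
    proof (intro sum.neutral ballI)
      fix k assume "k \<in> {..<n}"
      then show "K $$ (i, k) * d $$ (k, n - 1 - l) = 0"
        using K(4)[of i k] E(3)[of "n - 1 - l" k] il by (cases "k = n - 1 - i") auto
    qed
    finally show ?thesis using 1 eq K(4)[of l "n - 1 - l"] il by (simp add: K_def)
  qed
  then show a1: "a = 1\<^sub>m n"
  proof (intro eq_matI)
    fix i j assume "i < dim_row (1\<^sub>m n)" "j < dim_col (1\<^sub>m n)"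
    then show "a $$ (i, j) = 1\<^sub>m n $$ (i, j)"
      using A(3)[of j i] A(4)[of i] \<open>\<And>i l. i < l \<Longrightarrow> l < n \<Longrightarrow> a $$ (i, l) = 0\<close>[of i j]
      by (cases i j rule: linorder_cases) auto
  qed (use A(1) in auto)
  \<comment> \<open>With \<open>a\<close> trivial the hypothesis reads \<open>K = K * d\<close>, and
    \<open>K\<close> is cancelled.\<close>
  note m = minv[OF K(1,2)]
  have "d = (minv K * K) * d" using m E(1) by simp
  also have "\<dots> = minv K * (K * d)" using m(1) K(1) E(1) by (simp add: assoc_mult_mat[of _ n n _ n _ n])
  also have "K * d = K" using eq a1 K(1) by (simp add: K_def)
  finally show "d = 1\<^sub>m n" using m by simp
qed

section \<open>Bruhat coordinates on the cell\<close>

definition cell :: "nat \<Rightarrow> int vec \<Rightarrow> real mat \<Rightarrow> real mat \<Rightarrow> real mat" where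
  "cell n D b1 b2 = b1 * c_mat n D * long_weyl n * b2"

lemma cell_assoc:
  assumes "b1 \<in> U_R n" "b2 \<in> U_R n"
  shows "cell n D b1 b2 = b1 * ((c_mat n D * long_weyl n) * b2)"
  using U_R_D(1)[OF assms(1)] U_R_D(1)[OF assms(2)]
  by (simp add: cell_def assoc_mult_mat[of _ n n _ n _ n])

text \<open>Two decompositions of one matrix give the intertwining pair \<open>minv b1' * b1\<close>
  and \<open>b2' * minv b2\<close>, which \<open>cell_intertwine\<close> shows to be
  trivial.\<close>

lemma cell_unique:
  assumes D: "pos_vec n D" and b: "b1 \<in> U_R n" "b2 \<in> U_R n" "b1' \<in> U_R n" "b2' \<in> U_R n"
    and eq: "cell n D b1 b2 = cell n D b1' b2'"
  shows "b1 = b1'" "b2 = b2'"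
proof -
  define K where "K = c_mat n D * long_weyl n"
  have K: "K \<in> carrier_mat n n" by (simp add: K_def)
  note B = b[THEN U_R_D(1)]
  have d: "det b1' \<noteq> 0" "det b2 \<noteq> 0" using b U_R_D(2) by fastforce+
  note p = minv[OF B(3) d(1)] and q = minv[OF B(2) d(2)]
  have eq': "b1 * (K * b2) = b1' * (K * b2')"
    using eq b by (simp add: cell_assoc K_def)
  have "(minv b1' * b1) * K = minv b1' * (b1 * (K * b2)) * minv b2"
    using p q K B by (simp add: assoc_mult_mat[of _ n n _ n _ n])
  also have "\<dots> = (minv b1' * b1') * (K * (b2' * minv b2))"
    unfolding eq' using p(1) q(1) K B by (simp add: assoc_mult_mat[of _ n n _ n _ n])
  also have "\<dots> = K * (b2' * minv b2)" using p q K B by simp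
  finally have "(minv b1' * b1) * K = K * (b2' * minv b2)" .
  from cell_intertwine[OF D _ _ this[unfolded K_def]] b
  have 1: "minv b1' * b1 = 1\<^sub>m n" "b2' * minv b2 = 1\<^sub>m n"
    by (auto simp: U_R_mult U_R_minv)
  have "b1 = (b1' * minv b1') * b1" using p B by simp
  also have "\<dots> = b1' * (minv b1' * b1)" using p(1) B by (simp add: assoc_mult_mat[of _ n n _ n _ n])
  finally show "b1 = b1'" using 1 B by simp
  have "b2' = b2' * (minv b2 * b2)" using q B by simp
  also have "\<dots> = (b2' * minv b2) * b2" using q(1) B by (simp add: assoc_mult_mat[of _ n n _ n _ n])
  finally show "b2 = b2'" using 1 B by simp
qed

lemma mu_cell:
  assumes "pos_vec n D" "b1 \<in> U_R n" "b2 \<in> U_R n"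
  shows "mu n D (cell n D b1 b2) = b1" "mu' n D (cell n D b1 b2) = b2"
  using assms cell_unique[OF assms(1)]
  unfolding mu_def mu'_def cell_def[symmetric] by (blast intro!: the_equality)+

lemma cell_translate:
  assumes "b1 \<in> U_R n" "b2 \<in> U_R n" "u \<in> U_R n" "v \<in> U_R n"
  shows "u * cell n D b1 b2 * v = cell n D (u * b1) (b2 * v)"
  using assms[THEN U_R_D(1)] by (simp add: cell_def assoc_mult_mat[of _ n n _ n _ n])

text \<open>The automorphism acts factor by factor, and only the middle factor changes
  \<open>D\<close> to its reversal.\<close>

lemma contra_cell:
  assumes D: "pos_vec n D" and b: "b1 \<in> U_R n" "b2 \<in> U_R n"
  shows "contra n (cell n D b1 b2) = cell n (tilde D) (contra n b1) (contra n b2)"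
proof -
  note K = cell_middle[OF D]
  have d: "det b1 = 1" "det b2 = 1" using b U_R_D(2) by auto
  note B = b[THEN U_R_D(1)]
  have "contra n (cell n D b1 b2) = contra n b1 * (contra n (c_mat n D * long_weyl n) * contra n b2)"
    using K(1,2) B d by (simp add: cell_assoc[OF b] contra_mult det_mult[of _ n] del: assoc_mult_mat)
  then show ?thesis using K(3) b by (simp add: cell_assoc contra_U_R)
qed

section \<open>The sum over double cosets\<close>

lemma C_set_cell: "C_set n D = {cell n D b1 b2 | b1 b2. b1 \<in> U_R n \<and> b2 \<in> U_R n} \<inter> SL_Z n"
  by (simp add: C_set_def cell_def)

lemma C_set_carrier: "g \<in> C_set n D \<Longrightarrow> g \<in> carrier_mat n n \<and> det g = 1"
  by (simp add: C_set_def SL_Z_def)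

lemma contra_C_set:
  assumes "pos_vec n D" "g \<in> C_set n D"
  shows "contra n g \<in> C_set n (tilde D)"
  using assms contra_SL_Z by (fastforce simp: C_set_cell contra_cell contra_U_R)

text \<open>\<open>contra\<close> is multiplicative and preserves \<open>U_Z n\<close>, which gives
  one inclusion; being an involution, it gives the other.\<close>

lemma contra_double_coset:
  assumes g: "g \<in> carrier_mat n n" "det g = 1"
  shows "contra n ` double_coset n g = double_coset n (contra n g)"
proof -
  have c: "contra n (u * g * v) = contra n u * contra n g * contra n v"
    if "u \<in> U_Z n" "v \<in> U_Z n" for u v
    using that[THEN U_Z_U_R, THEN U_R_D(1)] that[THEN U_Z_U_R, THEN U_R_D(2)] g
    by (simp add: contra_mult det_mult[of _ n] del: assoc_mult_mat)
  show ?thesis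
  proof (intro equalityI subsetI)
    fix x assume "x \<in> contra n ` double_coset n g"
    then show "x \<in> double_coset n (contra n g)"
      using c contra_U_Z by (fastforce simp: double_coset_def)
  next
    fix x assume "x \<in> double_coset n (contra n g)"
    then obtain u v where uv: "u \<in> U_Z n" "v \<in> U_Z n" "x = u * contra n g * v"
      by (auto simp: double_coset_def)
    have "contra n (contra n u) = u" "contra n (contra n v) = v"
      using contra(3) uv(1,2)[THEN U_Z_U_R, THEN U_R_D(1)] uv(1,2)[THEN U_Z_U_R, THEN U_R_D(2)]
      by simp_all
    then have "x = contra n (contra n u * g * contra n v)"
      using c contra_U_Z uv by simp
    moreover have "contra n u * g * contra n v \<in> double_coset n g"
      using uv contra_U_Z unfolding double_coset_def by blast
    ultimately show "x \<in> contra n ` double_coset n g" by simp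
  qed
qed

lemma contra_X_set:
  assumes D: "pos_vec n D" and x: "x \<in> X_set n D"
  shows "contra n ` x \<in> X_set n (tilde D)" "contra n ` contra n ` x = x"
proof -
  obtain g where g: "g \<in> C_set n D" "x = double_coset n g" using x by (auto simp: X_set_def)
  note gc = C_set_carrier[OF g(1)]
  have *: "contra n ` x = double_coset n (contra n g)"
    using contra_double_coset gc g(2) by simp
  then show "contra n ` x \<in> X_set n (tilde D)"
    using contra_C_set[OF D g(1)] by (auto simp: X_set_def)
  show "contra n ` contra n ` x = x"
    unfolding * using contra[of g n] gc g(2) by (simp add: contra_double_coset)
qed

section \<open>The summand as a function of a representative\<close>

definition summand :: "nat \<Rightarrow> int vec \<Rightarrow> int vec \<Rightarrow> int vec \<Rightarrow> real mat \<Rightarrow> complex" where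
  "summand n M N D g = psi (tilde M) (mu n D g) * psi N (mu' n D g)"

text \<open>Translation by \<open>U_Z n\<close> multiplies the coordinates by integral unipotents,
  on which the characters are trivial. Hence the choice of representative by \<open>SOME\<close> is
  harmless.\<close>

lemma summand_double_coset:
  assumes D: "pos_vec n D" and MN: "M \<in> carrier_vec (n - 1)" "N \<in> carrier_vec (n - 1)"
    and g: "g \<in> C_set n D" and h: "h \<in> double_coset n g"
  shows "summand n M N D h = summand n M N D g"
proof -
  obtain b1 b2 where b: "b1 \<in> U_R n" "b2 \<in> U_R n" "g = cell n D b1 b2"
    using g by (auto simp: C_set_cell)
  obtain u v where uv: "u \<in> U_Z n" "v \<in> U_Z n" "h = u * g * v"
    using h by (auto simp: double_coset_def)
  note UV = uv(1,2)[THEN U_Z_U_R]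
  have "h = cell n D (u * b1) (b2 * v)" using cell_translate b uv UV by simp
  then show ?thesis
    using MN b uv UV D
    by (simp add: summand_def mu_cell U_R_mult psi_mult[of _ n] psi_U_Z[of _ n])
qed

lemma summand_contra:
  assumes D: "pos_vec n D" and MN: "M \<in> carrier_vec (n - 1)" "N \<in> carrier_vec (n - 1)"
    and g: "g \<in> C_set n D"
  shows "summand n (tilde M) (tilde N) (tilde D) (contra n g) = summand n M N D g"
proof -
  obtain b1 b2 where b: "b1 \<in> U_R n" "b2 \<in> U_R n" "g = cell n D b1 b2"
    using g by (auto simp: C_set_cell)
  then show ?thesis
    \<comment> \<open>The left coordinate is paired with the already reversed \<open>M\<close>, so
      the character identity is applied to \<open>tilde M\<close>.\<close>
    using MN D pos_vec_tilde[OF D] psi_contra[of "tilde M" n b1]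
    by (simp add: summand_def contra_cell mu_cell contra_U_R psi_contra)
qed

lemma double_coset_self: "g \<in> carrier_mat n n \<Longrightarrow> g \<in> double_coset n g"
  unfolding double_coset_def using one_U_Z[of n]
  by (intro CollectI exI[of _ "1\<^sub>m n"]) simp

theorem proposition3p6:
  fixes n :: nat and M N D :: "int vec"
  assumes "n \<ge> 2"
    and "M \<in> carrier_vec (n - 1)"
    and "N \<in> carrier_vec (n - 1)"
    and "D \<in> carrier_vec (n - 1)"
    and "\<forall>i<n - 1. D $ i > 0"
  shows "kloosterman n M N D = kloosterman n (tilde M) (tilde N) (tilde D)"
proof -
  have D: "pos_vec n D" using assms by (simp add: pos_vec_def)
  note D' = pos_vec_tilde[OF D]
  \<comment> \<open>Replaces the chosen representative by any convenient one; the image coset can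
    then be evaluated at \<open>contra n g\<close>.\<close>
  have rep: "summand n M' N' D' (SOME h. h \<in> double_coset n g) = summand n M' N' D' g"
    if "pos_vec n D'" "M' \<in> carrier_vec (n - 1)" "N' \<in> carrier_vec (n - 1)" "g \<in> C_set n D'"
    for M' N' D' g
    using that double_coset_self C_set_carrier[OF that(4)] someI[of "\<lambda>h. h \<in> double_coset n g" g]
    by (intro summand_double_coset) auto
  have "(\<Sum>x\<in>X_set n D. summand n M N D (SOME g. g \<in> x)) =
      (\<Sum>x\<in>X_set n (tilde D). summand n (tilde M) (tilde N) (tilde D) (SOME g. g \<in> x))"
  \<comment> \<open>Taking images under the involution \<open>contra n\<close> is its own inverse on
    double cosets, so it serves in both directions.\<close>
  proof (rule sum.reindex_bij_witness[of _ "(`) (contra n)" "(`) (contra n)"])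
    fix x assume "x \<in> X_set n D"
    then obtain g where g: "g \<in> C_set n D" "x = double_coset n g" by (auto simp: X_set_def)
    then show "summand n (tilde M) (tilde N) (tilde D) (SOME g. g \<in> contra n ` x) =
        summand n M N D (SOME g. g \<in> x)"
      using rep[OF D assms(2,3) g(1)] summand_contra[OF D assms(2,3) g(1)]
        rep[OF D' _ _ contra_C_set[OF D g(1)], of "tilde M" "tilde N"] assms(2,3)
        contra_double_coset C_set_carrier[OF g(1)] by simp
  qed (use contra_X_set[OF D] contra_X_set[OF D'] in \<open>auto simp: tilde_tilde\<close>)
  then show ?thesis by (simp add: kloosterman_def summand_def Let_def)
qed

end
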